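(* Let $P(\lambda)\in\mathbb{C}^{n,n}[\lambda]$ be a matrix polynomial and let $D$ be a nonempty open or closed subset of $\mathbb{C}$. Then the following holds. (i) If $P(\lambda)$ is strongly equivalent to an upper triangular matrix polynomial, then $P(\lambda)$ is hyperstable with respect to $D$ if and only if it is stable with respect to $D$. (ii) If $P(\lambda)=p(\lambda)A+q(\lambda)B$ with some scalar polynomials $p(\lambda),q(\lambda)\in\mathbb{C}[\lambda]$ and matrices $A,B\in\mathbb{C}^{n,n}$ (in particular, if $P(\lambda)$ is a matrix pencil, i.e. a matrix polynomial of degree one), then $P(\lambda)$ is hyperstable with respect to $D$ if and only if it is stable with respect to $D$.
   Context: $\mathbb{C}^{n,n}[\lambda]$ denotes the polynomials in $\lambda$ with coefficients in $\mathbb{C}^{n,n}$ ($n\times n$ complex matrices). For a nonempty open or closed $D\subseteq\mathbb{C}$: $P$ is stable with respect to $D$ if it has no eigenvalues in $D$, i.e. $\det P(\mu)\neq0$ for all $\mu\in D$; $P$ is hyperstable with respect to $D$ if for every $x\in\mathbb{C}^n\setminus\{0\}$ there exists $y\in\mathbb{C}^n\setminus\{0\}$ such that $y^*P(\mu)x\neq0$ for all $\mu\in D$. Matrix polynomials $P,Q\in\mathbb{C}^{n,n}[\lambda]$ are strongly equivalent if $P(\lambda)=UQ(\lambda)V$ for some constant invertible matrices $U,V\in\mathbb{C}^{n,n}$. *)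

theory Defs
  imports
    "Jordan_Normal_Form.Determinant"
    "Jordan_Normal_Form.Schur_Decomposition"
begin

text \<open>A matrix polynomial in $\mathbb{C}^{n,n}[\lambda]$ is represented by the matrix of its
  entries, i.e. an element of \<^term>\<open>carrier_mat n n :: complex poly mat set\<close>; its matrix
  coefficients are recovered by \<open>mat_coeff\<close>.\<close>

definition mat_coeff :: "complex poly mat \<Rightarrow> nat \<Rightarrow> complex mat" where
  "mat_coeff P k = map_mat (\<lambda>p. coeff p k) P"

text \<open>Same convention as \<^const>\<open>degree\<close>: the zero matrix polynomial has degree 0.\<close>

definition mat_poly_degree :: "complex poly mat \<Rightarrow> nat" where
  "mat_poly_degree P = (LEAST d. \<forall>k>d. mat_coeff P k = 0\<^sub>m (dim_row P) (dim_col P))"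

definition eval_mat :: "complex poly mat \<Rightarrow> complex \<Rightarrow> complex mat" where
  "eval_mat P \<mu> = map_mat (\<lambda>p. poly p \<mu>) P"

definition const_mat :: "complex mat \<Rightarrow> complex poly mat" where
  "const_mat A = map_mat (\<lambda>c. [:c:]) A"

definition stable_wrt :: "complex set \<Rightarrow> complex poly mat \<Rightarrow> bool" where
  "stable_wrt D P \<longleftrightarrow> (\<forall>\<mu>\<in>D. det (eval_mat P \<mu>) \<noteq> 0)"

text \<open>The form $y^* M x$ is \<open>conjugate y \<bullet> (M *\<^sub>v x)\<close>, since \<open>\<bullet>\<close> on \<^typ>\<open>complex vec\<close> is the bilinear
  (unconjugated) scalar product. Note that $y$ is chosen before $\mu$.\<close>

definition hyperstable_wrt :: "nat \<Rightarrow> complex set \<Rightarrow> complex poly mat \<Rightarrow> bool" where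
  "hyperstable_wrt n D P \<longleftrightarrow>
     (\<forall>x \<in> carrier_vec n - {0\<^sub>v n}. \<exists>y \<in> carrier_vec n - {0\<^sub>v n}.
        \<forall>\<mu>\<in>D. conjugate y \<bullet> (eval_mat P \<mu> *\<^sub>v x) \<noteq> 0)"

definition strongly_equivalent :: "nat \<Rightarrow> complex poly mat \<Rightarrow> complex poly mat \<Rightarrow> bool" where
  "strongly_equivalent n P Q \<longleftrightarrow>
     (\<exists>U \<in> carrier_mat n n. \<exists>V \<in> carrier_mat n n.
        invertible_mat U \<and> invertible_mat V \<and> P = const_mat U * Q * const_mat V)"

end

theory Submission
  imports Defs "Subresultants.More_Homomorphisms"
begin

text \<open>For \<open>P = U T V\<close> with \<open>T\<close> upper triangular and \<open>x \<noteq> 0\<close>, let \<open>k\<close> be the last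
  index with \<open>(V x)\<^sub>k \<noteq> 0\<close>; then the \<open>k\<close>-th entry of \<open>U\<inverse> P(\<mu>) x = T(\<mu>) V x\<close> is
  \<open>T\<^sub>k\<^sub>k(\<mu>) (V x)\<^sub>k\<close>, which stability keeps away from \<open>0\<close>, so the \<open>k\<close>-th row of \<open>U\<inverse>\<close> serves
  as \<open>y\<^sup>*\<close>. The case \<open>P = p A + q B\<close> reduces to this one without the generalized Schur form:
  fix \<open>\<mu>\<^sub>0 \<in> D\<close>. The matrix \<open>M = P(\<mu>\<^sub>0)\<close> is invertible, and one of \<open>A\<close>, \<open>B\<close>, say \<open>A\<close>, is a
  linear combination of \<open>M\<close> and \<open>B\<close>, so \<open>P = M (p' I + q' M\<inverse>B)\<close>, and the ordinary Schur form
  of \<open>M\<inverse>B\<close> makes \<open>P\<close> strongly equivalent to a triangular matrix polynomial.\<close>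

section \<open>Evaluation, constant matrices and inverses\<close>

lemma const_mat_carrier [simp]: "const_mat A \<in> carrier_mat m n \<longleftrightarrow> A \<in> carrier_mat m n"
  by (simp add: const_mat_def)

lemma eval_mat_carrier [simp]: "eval_mat P \<mu> \<in> carrier_mat m n \<longleftrightarrow> P \<in> carrier_mat m n"
  by (simp add: eval_mat_def)

lemma eval_mat_const [simp]: "eval_mat (const_mat A) \<mu> = A"
  by (rule eq_matI) (auto simp: eval_mat_def const_mat_def)

lemma eval_mat_mult:
  assumes "P \<in> carrier_mat l m" "Q \<in> carrier_mat m n"
  shows "eval_mat (P * Q) \<mu> = eval_mat P \<mu> * eval_mat Q \<mu>"
  unfolding eval_mat_def by (rule semiring_hom.mat_hom_mult[OF poly_hom.semiring_hom_axioms assms])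

lemma const_mat_mult:
  assumes "A \<in> carrier_mat l m" "B \<in> carrier_mat m n"
  shows "const_mat (A * B) = const_mat A * const_mat B"
  unfolding const_mat_def by (rule coeff_lift_hom.mat_hom_mult[OF assms])

lemma invertible_matE:
  assumes "invertible_mat U" "U \<in> carrier_mat n n"
  obtains U' where "U' \<in> carrier_mat n n" "U' * U = 1\<^sub>m n" "U * U' = 1\<^sub>m n"
proof -
  from assms obtain B where B: "U * B = 1\<^sub>m n" "B * U = 1\<^sub>m (dim_row B)"
    unfolding invertible_mat_def inverts_mat_def by auto
  \<comment> \<open>The inverse comes without dimensions; comparing column counts in both identities
    forces it to be n by n.\<close>
  have "dim_col B = n" "dim_row B = n"
    using arg_cong[OF B(1), of dim_col] arg_cong[OF B(2), of dim_col] assms(2) by auto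
  then show ?thesis
    using B that[of B] by auto
qed

lemma invertible_matI:
  assumes "U \<in> carrier_mat n n" "U' \<in> carrier_mat n n" "U * U' = 1\<^sub>m n" "U' * U = 1\<^sub>m n"
  shows "invertible_mat U"
  using assms unfolding invertible_mat_def inverts_mat_def by auto

lemma mult_mat_vec_zero: "A \<in> carrier_mat m n \<Longrightarrow> A *\<^sub>v 0\<^sub>v n = 0\<^sub>v m"
  by (rule eq_vecI) auto

section \<open>Stability against hyperstability for triangular forms\<close>

text \<open>A nonzero kernel vector \<open>x\<close> of a singular \<open>eval_mat P \<mu>\<close>
  makes the form vanish for every \<open>y\<close>.\<close>

lemma hyperstable_imp_stable:
  assumes P: "P \<in> carrier_mat n n" and hyp: "hyperstable_wrt n D P"
  shows "stable_wrt D P"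
  unfolding stable_wrt_def
proof (intro ballI notI)
  fix \<mu> assume \<mu>: "\<mu> \<in> D" and "det (eval_mat P \<mu>) = 0"
  then obtain x where x: "x \<in> carrier_vec n" "x \<noteq> 0\<^sub>v n" "eval_mat P \<mu> *\<^sub>v x = 0\<^sub>v n"
    using det_0_iff_vec_prod_zero_field[of "eval_mat P \<mu>" n] P by auto
  then obtain y where "y \<in> carrier_vec n" "conjugate y \<bullet> (eval_mat P \<mu> *\<^sub>v x) \<noteq> 0"
    using hyp \<mu> unfolding hyperstable_wrt_def by blast
  with x(3) show False by simp
qed

text \<open>Left of the diagonal the row of \<open>T\<close> vanishes, right of it \<open>z\<close>
  does; only the diagonal term survives.\<close>

lemma upper_triangular_mult_vec_last:
  fixes T :: "'a :: comm_semiring_1 mat"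
  assumes T: "T \<in> carrier_mat n n" "upper_triangular T"
    and z: "z \<in> carrier_vec n" and k: "k < n" and last: "\<And>j. k < j \<Longrightarrow> j < n \<Longrightarrow> z $ j = 0"
  shows "(T *\<^sub>v z) $ k = T $$ (k, k) * z $ k"
proof -
  have "(T *\<^sub>v z) $ k = (\<Sum>j<n. T $$ (k, j) * z $ j)"
    using T z k by (simp add: scalar_prod_def atLeast0LessThan)
  also have "\<dots> = (\<Sum>j<n. if j = k then T $$ (k, k) * z $ k else 0)"
  proof (rule sum.cong[OF refl])
    fix j assume "j \<in> {..<n}"
    then show "T $$ (k, j) * z $ j = (if j = k then T $$ (k, k) * z $ k else 0)"
      using last[of j] upper_triangularD[OF T(2), of j k] T(1) k
      by (cases j k rule: linorder_cases) auto
  qed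
  also have "\<dots> = T $$ (k, k) * z $ k"
    using k by simp
  finally show ?thesis .
qed

lemma vec_last_nonzero:
  assumes "z \<in> carrier_vec n" "z \<noteq> 0\<^sub>v n"
  obtains k where "k < n" "z $ k \<noteq> 0" "\<And>j. k < j \<Longrightarrow> j < n \<Longrightarrow> z $ j = 0"
proof -
  let ?S = "{i. i < n \<and> z $ i \<noteq> 0}"
  have "?S \<noteq> {}"
    using assms by (auto intro!: eq_vecI)
  moreover have fin: "finite ?S" by simp
  ultimately have "Max ?S \<in> ?S" by (rule Max_in[rotated])
  then show ?thesis
    using that[of "Max ?S"] Max_ge[OF fin] by fastforce
qed

text \<open>The index \<open>k\<close> depends on \<open>V\<close> and \<open>x\<close> but not on
  \<mu>, which is why a single \<open>y\<close> serves all of \<open>D\<close>.\<close>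

lemma stable_imp_hyperstable_triangular:
  assumes D: "D \<noteq> {}" and T: "T \<in> carrier_mat n n" "upper_triangular T"
    and eqv: "strongly_equivalent n P T" and stable: "stable_wrt D P"
  shows "hyperstable_wrt n D P"
proof -
  from eqv obtain U V where U: "U \<in> carrier_mat n n" "invertible_mat U"
    and V: "V \<in> carrier_mat n n" "invertible_mat V" and P: "P = const_mat U * T * const_mat V"
    unfolding strongly_equivalent_def by blast
  obtain U' where U': "U' \<in> carrier_mat n n" "U' * U = 1\<^sub>m n"
    using invertible_matE[OF U(2,1)] by metis
  obtain V' where V': "V' \<in> carrier_mat n n" "V' * V = 1\<^sub>m n"
    using invertible_matE[OF V(2,1)] by metis
  have ev: "eval_mat P \<mu> = U * eval_mat T \<mu> * V" for \<mu>
    using U V T unfolding P by (simp add: eval_mat_mult[of _ n n _ n])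
  \<comment> \<open>The determinant of the triangular factor is the product of its diagonal and
    divides that of \<open>eval_mat P \<mu>\<close>.\<close>
  have diag: "poly (T $$ (k, k)) \<mu> \<noteq> 0" if "\<mu> \<in> D" "k < n" for \<mu> k
  proof
    assume 0: "poly (T $$ (k, k)) \<mu> = 0"
    have "upper_triangular (eval_mat T \<mu>)"
      using T unfolding eval_mat_def upper_triangular_def by auto
    then have "det (eval_mat T \<mu>) = prod_list (diag_mat (eval_mat T \<mu>))"
      using T(1) by (intro det_upper_triangular) auto
    also have "\<dots> = 0"
      using 0 \<open>k < n\<close> T(1) unfolding prod_list_zero_iff diag_mat_def eval_mat_def
      by (force simp: image_iff)
    finally have "det (eval_mat P \<mu>) = 0"
      unfolding ev using U V T by (simp add: det_mult[of _ n])
    with stable \<open>\<mu> \<in> D\<close> show False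
      unfolding stable_wrt_def by blast
  qed
  show ?thesis
    unfolding hyperstable_wrt_def
  proof
    fix x :: "complex vec"
    assume "x \<in> carrier_vec n - {0\<^sub>v n}"
    then have x: "x \<in> carrier_vec n" "x \<noteq> 0\<^sub>v n" by auto
    let ?z = "V *\<^sub>v x"
    have z: "?z \<in> carrier_vec n" using V x by simp
    have "V' *\<^sub>v ?z = x"
      using assoc_mult_mat_vec[OF V'(1) V(1) x(1)] V'(2) x by simp
    then have "?z \<noteq> 0\<^sub>v n"
      using x mult_mat_vec_zero[OF V'(1)] by auto
    then obtain k where k: "k < n" "?z $ k \<noteq> 0" "\<And>j. k < j \<Longrightarrow> j < n \<Longrightarrow> ?z $ j = 0"
      using vec_last_nonzero[OF z] by metis
    \<comment> \<open>The conjugate cancels the one in the form, so \<open>conjugate y\<close> is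
      row \<open>k\<close> of the inverse of \<open>U\<close>.\<close>
    define y where "y = conjugate (row U' k)"
    have y: "y \<in> carrier_vec n"
      using U' k unfolding y_def by (simp add: carrier_vecI)
    have nz: "conjugate y \<bullet> (eval_mat P \<mu> *\<^sub>v x) \<noteq> 0" if "\<mu> \<in> D" for \<mu>
    proof -
      have Tz: "eval_mat T \<mu> *\<^sub>v ?z \<in> carrier_vec n"
        by (rule mult_mat_vec_carrier[OF _ z]) (simp add: T(1))
      have Px: "eval_mat P \<mu> *\<^sub>v x = U *\<^sub>v (eval_mat T \<mu> *\<^sub>v ?z)"
        unfolding ev using U V T x by (simp add: assoc_mult_mat_vec[of _ n n _ n])
      have "U' *\<^sub>v (eval_mat P \<mu> *\<^sub>v x) = (U' * U) *\<^sub>v (eval_mat T \<mu> *\<^sub>v ?z)"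
        unfolding Px by (rule assoc_mult_mat_vec[OF U'(1) U(1) Tz, symmetric])
      also have "\<dots> = eval_mat T \<mu> *\<^sub>v ?z"
        using U'(2) Tz by simp
      finally have "conjugate y \<bullet> (eval_mat P \<mu> *\<^sub>v x) = (eval_mat T \<mu> *\<^sub>v ?z) $ k"
        using U' k by (simp add: y_def flip: index_mult_mat_vec)
      also have "\<dots> = eval_mat T \<mu> $$ (k, k) * ?z $ k"
        using T z k by (intro upper_triangular_mult_vec_last[of _ n])
          (auto simp: eval_mat_def upper_triangular_def)
      finally show ?thesis
        using diag[OF that k(1)] k T(1) by (simp add: eval_mat_def)
    qed
    \<comment> \<open>A single point of \<open>D\<close> where the form is nonzero already rules out
      \<open>y = 0\<close>.\<close>
    obtain \<mu> where \<mu>: "\<mu> \<in> D" using D by blast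
    have "y \<noteq> 0\<^sub>v n"
    proof
      assume "y = 0\<^sub>v n"
      moreover have "eval_mat P \<mu> *\<^sub>v x \<in> carrier_vec n"
        unfolding ev using U V x by (intro mult_mat_vec_carrier[of _ n n]) (use T in auto)
      ultimately show False using nz[OF \<mu>] by simp
    qed
    with y nz show "\<exists>y\<in>carrier_vec n - {0\<^sub>v n}. \<forall>\<mu>\<in>D. conjugate y \<bullet> (eval_mat P \<mu> *\<^sub>v x) \<noteq> 0"
      by blast
  qed
qed

lemma hyperstable_iff_stable_triangular:
  assumes "P \<in> carrier_mat n n" "D \<noteq> {}" "T \<in> carrier_mat n n" "upper_triangular T"
    and "strongly_equivalent n P T"
  shows "hyperstable_wrt n D P \<longleftrightarrow> stable_wrt D P"
  using hyperstable_imp_stable stable_imp_hyperstable_triangular assms by blast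

section \<open>Combinations of two constant matrices\<close>

text \<open>If \<open>M'\<close> inverts \<open>M\<close> and \<open>M' * B = W * S * W'\<close> is
  a Schur form, then p M + q B = (M W)(p I + q S) W', with a triangular middle factor.\<close>

lemma combination_equivalent_triangular:
  fixes p q :: "complex poly"
  assumes M: "M \<in> carrier_mat n n" "det M \<noteq> 0" and B: "B \<in> carrier_mat n n"
  shows "\<exists>T \<in> carrier_mat n n. upper_triangular T \<and>
    strongly_equivalent n (p \<cdot>\<^sub>m const_mat M + q \<cdot>\<^sub>m const_mat B) T"
proof -
  obtain M' where M': "M' \<in> carrier_mat n n" "M' * M = 1\<^sub>m n" "M * M' = 1\<^sub>m n"
    using det_non_zero_imp_unit[OF M, of "()"] unfolding Units_def ring_mat_def by auto
  have C: "M' * B \<in> carrier_mat n n" using M' B by simp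
  \<comment> \<open>Over the complex numbers the characteristic polynomial splits, as the Schur
    decomposition requires.\<close>
  obtain es where "char_poly (M' * B) = (\<Prod>e\<leftarrow>es. [:- e, 1:])"
    using char_poly_factorized[OF C] by blast
  then obtain S where S: "S \<in> carrier_mat n n" "upper_triangular S" "similar_mat (M' * B) S"
    using schur_decomposition_exists[OF C] by blast
  then obtain W W' where "similar_mat_wit (M' * B) S W W'"
    unfolding similar_mat_def by blast
  from similar_mat_witD2[OF C this]
  have WW': "W * W' = 1\<^sub>m n" and MB: "M' * B = W * S * W'"
    and W: "W \<in> carrier_mat n n" and W': "W' \<in> carrier_mat n n" by blast+
  note assoc = assoc_mult_mat[of _ n n _ n _ n]
  let ?T = "p \<cdot>\<^sub>m 1\<^sub>m n + q \<cdot>\<^sub>m const_mat S"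
  have MWS: "M * W * S * W' = B"
  proof -
    have "M * W * S * W' = M * (W * S * W')"
      using M(1) W W' S(1) by (simp add: assoc)
    also have "\<dots> = (M * M') * B"
      unfolding MB[symmetric] by (rule assoc_mult_mat[OF M(1) M'(1) B, symmetric])
    finally show ?thesis using M'(3) B by simp
  qed
  have MW: "M * W * W' = M"
    unfolding assoc_mult_mat[OF M(1) W W'] WW' using M(1) by simp
  let ?U = "const_mat (M * W)" and ?V = "const_mat W'"
  have car: "?U \<in> carrier_mat n n" "?V \<in> carrier_mat n n" "const_mat S \<in> carrier_mat n n"
    using M(1) W W' S(1) by auto
  have "?U * ?T * ?V = (p \<cdot>\<^sub>m ?U + q \<cdot>\<^sub>m (?U * const_mat S)) * ?V"
    using car by (simp add: mult_add_distrib_mat[of _ n n _ n] mult_smult_distrib[of _ n n _ n])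
  also have "\<dots> = p \<cdot>\<^sub>m (?U * ?V) + q \<cdot>\<^sub>m (?U * const_mat S * ?V)"
    using car by (simp add: add_mult_distrib_mat[of _ n n _ _ n] mult_smult_assoc_mat[of _ n n _ n])
  also have "?U * ?V = const_mat M"
    using const_mat_mult[of "M * W" n n W' n] M(1) W W' MW by simp
  also have "?U * const_mat S * ?V = const_mat B"
    using const_mat_mult[of "M * W * S" n n W' n] const_mat_mult[of "M * W" n n S n]
      M(1) W W' S(1) MWS by simp
  finally have eq: "p \<cdot>\<^sub>m const_mat M + q \<cdot>\<^sub>m const_mat B = ?U * ?T * ?V" by simp
  have MW_car: "M * W \<in> carrier_mat n n" and W'M'_car: "W' * M' \<in> carrier_mat n n"
    using M(1) M'(1) W W' by auto
  have "(M * W) * (W' * M') = (M * W * W') * M'"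
    by (rule assoc_mult_mat[OF MW_car W' M'(1), symmetric])
  then have inv: "(M * W) * (W' * M') = 1\<^sub>m n" unfolding MW M'(3) .
  have "invertible_mat (M * W)"
    by (rule invertible_matI[OF MW_car W'M'_car inv
      mat_mult_left_right_inverse[OF MW_car W'M'_car inv]])
  moreover have "invertible_mat W'"
    by (rule invertible_matI[OF W' W mat_mult_left_right_inverse[OF W W' WW'] WW'])
  ultimately have "strongly_equivalent n (p \<cdot>\<^sub>m const_mat M + q \<cdot>\<^sub>m const_mat B) ?T"
    unfolding strongly_equivalent_def using eq MW_car W' by blast
  moreover have "?T \<in> carrier_mat n n" using S by simp
  moreover have "upper_triangular ?T"
    using S(1,2) unfolding upper_triangular_def const_mat_def by auto
  ultimately show ?thesis by blast
qed

text \<open>With a = p(\<mu>), b = q(\<mu>) and M = P(\<mu>) = a A + b B, substituting A = (M - b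
  B)/a gives P = (p/a) M + (q - (b/a) p) B, whose first matrix is invertible.\<close>

lemma regular_combination_equivalent_triangular:
  fixes p q :: "complex poly"
  assumes A: "A \<in> carrier_mat n n" and B: "B \<in> carrier_mat n n"
    and P: "P = p \<cdot>\<^sub>m const_mat A + q \<cdot>\<^sub>m const_mat B"
    and det: "det (eval_mat P \<mu>) \<noteq> 0" and nz: "poly p \<mu> \<noteq> 0"
  shows "\<exists>T \<in> carrier_mat n n. upper_triangular T \<and> strongly_equivalent n P T"
proof -
  let ?a = "poly p \<mu>" and ?b = "poly q \<mu>"
  have "P = smult (1 / ?a) p \<cdot>\<^sub>m const_mat (eval_mat P \<mu>)
      + (q - smult (?b / ?a) p) \<cdot>\<^sub>m const_mat B"
  proof (rule eq_matI)
    fix i j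
    assume "i < dim_row (smult (1 / ?a) p \<cdot>\<^sub>m const_mat (eval_mat P \<mu>)
      + (q - smult (?b / ?a) p) \<cdot>\<^sub>m const_mat B)"
      and "j < dim_col (smult (1 / ?a) p \<cdot>\<^sub>m const_mat (eval_mat P \<mu>)
      + (q - smult (?b / ?a) p) \<cdot>\<^sub>m const_mat B)"
    then have "i < n" "j < n" using B by (auto simp: const_mat_def)
    then show "P $$ (i, j) = (smult (1 / ?a) p \<cdot>\<^sub>m const_mat (eval_mat P \<mu>)
      + (q - smult (?b / ?a) p) \<cdot>\<^sub>m const_mat B) $$ (i, j)"
      using A B nz unfolding P const_mat_def eval_mat_def
      by (intro poly_eqI) (simp add: field_simps)
  qed (use A B in \<open>auto simp: P const_mat_def\<close>)
  moreover have "eval_mat P \<mu> \<in> carrier_mat n n" using A B P by simp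
  ultimately show ?thesis
    using combination_equivalent_triangular[OF _ det B] by metis
qed

lemma hyperstable_iff_stable_combination:
  fixes p q :: "complex poly"
  assumes D: "D \<noteq> {}" and A: "A \<in> carrier_mat n n" and B: "B \<in> carrier_mat n n"
    and P: "P = p \<cdot>\<^sub>m const_mat A + q \<cdot>\<^sub>m const_mat B"
  shows "hyperstable_wrt n D P \<longleftrightarrow> stable_wrt D P"
proof
  have carP: "P \<in> carrier_mat n n" using A B P by simp
  then show "stable_wrt D P" if "hyperstable_wrt n D P"
    using hyperstable_imp_stable that by blast
  assume stable: "stable_wrt D P"
  show "hyperstable_wrt n D P"
  \<comment> \<open>For \<open>n = 0\<close> there is no nonzero \<open>x\<close>. The case is
    separate because the empty matrix has determinant 1, so a nonzero determinant would not exclude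
    p(\<mu>) = q(\<mu>) = 0.\<close>
  proof (cases "n = 0")
    case True
    then show ?thesis unfolding hyperstable_wrt_def by auto
  next
    case False
    obtain \<mu> where "\<mu> \<in> D" using D by blast
    then have det: "det (eval_mat P \<mu>) \<noteq> 0"
      using stable unfolding stable_wrt_def by blast
    \<comment> \<open>Swapping the summands covers the case where only \<open>q\<close> is known to
      be nonzero at \<mu>.\<close>
    have P': "P = q \<cdot>\<^sub>m const_mat B + p \<cdot>\<^sub>m const_mat A"
      unfolding P using A B by (intro comm_add_mat[of _ n n]) auto
    have "poly p \<mu> \<noteq> 0 \<or> poly q \<mu> \<noteq> 0"
    proof (rule ccontr)
      assume "\<not> ?thesis"
      then have "eval_mat P \<mu> = 0\<^sub>m n n"
        using A B unfolding P by (intro eq_matI) (auto simp: eval_mat_def const_mat_def)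
      with det False show False by simp
    qed
    then obtain T where "T \<in> carrier_mat n n" "upper_triangular T" "strongly_equivalent n P T"
      using regular_combination_equivalent_triangular[OF A B P det]
        regular_combination_equivalent_triangular[OF B A P' det] by blast
    then show ?thesis
      using stable_imp_hyperstable_triangular D stable by blast
  qed
qed

section \<open>Degree and coefficients of pencils\<close>

text \<open>A bound on the degree exists, so the \<open>LEAST\<close> in \<^const>\<open>mat_poly_degree\<close> is attained.\<close>

lemma mat_coeff_above_degree:
  assumes "k > mat_poly_degree P"
  shows "mat_coeff P k = 0\<^sub>m (dim_row P) (dim_col P)"
proof -
  \<comment> \<open>If \<open>P\<close> has no entries, this is the \<open>Max\<close> of an empty
    set; its value is then irrelevant, since only existing entries are compared.\<close>
  let ?d = "Max ((\<lambda>x. degree (P $$ x)) ` ({..<dim_row P} \<times> {..<dim_col P}))"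
  have "\<forall>k>?d. mat_coeff P k = 0\<^sub>m (dim_row P) (dim_col P)"
  proof (intro allI impI eq_matI)
    fix k i j
    assume k: "?d < k" and "i < dim_row (0\<^sub>m (dim_row P) (dim_col P) :: complex mat)"
      "j < dim_col (0\<^sub>m (dim_row P) (dim_col P) :: complex mat)"
    then have ij: "i < dim_row P" "j < dim_col P" by auto
    then have "degree (P $$ (i, j)) \<le> ?d" by (intro Max_ge imageI) auto
    from le_less_trans[OF this k]
    show "mat_coeff P k $$ (i, j) = 0\<^sub>m (dim_row P) (dim_col P) $$ (i, j)"
      using ij by (simp add: mat_coeff_def coeff_eq_0)
  qed (auto simp: mat_coeff_def)
  then have "\<forall>k>mat_poly_degree P. mat_coeff P k = 0\<^sub>m (dim_row P) (dim_col P)"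
    unfolding mat_poly_degree_def by (rule LeastI)
  with assms show ?thesis by blast
qed

text \<open>Coefficients beyond the first vanish, so a pencil is a combination with scalar
  polynomials 1 and \<lambda>.\<close>

lemma pencil_eq:
  assumes "mat_poly_degree P = 1"
  shows "P = 1 \<cdot>\<^sub>m const_mat (mat_coeff P 0) + [:0, 1:] \<cdot>\<^sub>m const_mat (mat_coeff P 1)"
proof (rule eq_matI)
  fix i j
  assume "i < dim_row (1 \<cdot>\<^sub>m const_mat (mat_coeff P 0) + [:0, 1:] \<cdot>\<^sub>m const_mat (mat_coeff P 1))"
    "j < dim_col (1 \<cdot>\<^sub>m const_mat (mat_coeff P 0) + [:0, 1:] \<cdot>\<^sub>m const_mat (mat_coeff P 1))"
  then have ij: "i < dim_row P" "j < dim_col P"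
    by (auto simp: const_mat_def mat_coeff_def)
  have zero: "coeff (P $$ (i, j)) k = 0" if "k > 1" for k
    using arg_cong[OF mat_coeff_above_degree[of P k], of "\<lambda>M. M $$ (i, j)"] assms that ij
    by (simp add: mat_coeff_def)
  have "P $$ (i, j) = [:coeff (P $$ (i, j)) 0, coeff (P $$ (i, j)) 1:]"
    by (rule poly_eqI) (auto simp: coeff_pCons zero split: nat.split)
  then show "P $$ (i, j) = (1 \<cdot>\<^sub>m const_mat (mat_coeff P 0)
      + [:0, 1:] \<cdot>\<^sub>m const_mat (mat_coeff P 1)) $$ (i, j)"
    using ij by (simp add: const_mat_def mat_coeff_def)
qed (auto simp: const_mat_def mat_coeff_def)

theorem theorem3p6:
  fixes n :: nat and P :: "complex poly mat" and D :: "complex set"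
  assumes "P \<in> carrier_mat n n"
    and "D \<noteq> {}" and "open D \<or> closed D"
  shows
    "((\<exists>T \<in> carrier_mat n n. upper_triangular T \<and> strongly_equivalent n P T)
        \<longrightarrow> (hyperstable_wrt n D P \<longleftrightarrow> stable_wrt D P)) \<and>
     ((\<exists>(p :: complex poly) (q :: complex poly). \<exists>A \<in> carrier_mat n n. \<exists>B \<in> carrier_mat n n.
         P = p \<cdot>\<^sub>m const_mat A + q \<cdot>\<^sub>m const_mat B)
        \<longrightarrow> (hyperstable_wrt n D P \<longleftrightarrow> stable_wrt D P)) \<and>
     (mat_poly_degree P = 1 \<longrightarrow> (hyperstable_wrt n D P \<longleftrightarrow> stable_wrt D P))"
proof (intro conjI impI)
  assume "\<exists>T \<in> carrier_mat n n. upper_triangular T \<and> strongly_equivalent n P T"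
  then show "hyperstable_wrt n D P \<longleftrightarrow> stable_wrt D P"
    using hyperstable_iff_stable_triangular assms(1,2) by blast
next
  assume "\<exists>(p :: complex poly) (q :: complex poly). \<exists>A \<in> carrier_mat n n.
    \<exists>B \<in> carrier_mat n n. P = p \<cdot>\<^sub>m const_mat A + q \<cdot>\<^sub>m const_mat B"
  then show "hyperstable_wrt n D P \<longleftrightarrow> stable_wrt D P"
    using hyperstable_iff_stable_combination[OF assms(2)] by blast
next
  assume "mat_poly_degree P = 1"
  moreover have "mat_coeff P k \<in> carrier_mat n n" for k
    using assms(1) by (simp add: mat_coeff_def)
  ultimately show "hyperstable_wrt n D P \<longleftrightarrow> stable_wrt D P"
    using hyperstable_iff_stable_combination[OF assms(2) _ _ pencil_eq] by blast
qed

end
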